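(* Let $n\ge 3$ and let $W$ be the Weyl group of type $B_n$. Let $c=s_1s_2\cdots s_n$ and, for $2\le r\le n$, let $T_r=c^{r-1}s_1s_2\cdots s_{n-1}$. Then for every $2\le r\le n$ and every $j$ with $n+1-r\le j\le n-1$, the root $T_r(\alpha_j)$ is negative, i.e. $T_r(\alpha_j)<0$.
   Context: $\alpha_1,\dots,\alpha_n$ are the simple roots of the root system of type $B_n$ (the root system of $PSO(2n+1,\mathbb C)$) in the standard (Bourbaki) numbering, so $\alpha_n$ is the short simple root; $s_i$ is the simple reflection in $\alpha_i$. For a root $\beta$, $\beta<0$ means that $\beta$ is a negative root. *)

theory Defs
  imports "Jordan_Normal_Form.Matrix" "HOL-Algebra.Bij" "HOL-Algebra.Generated_Groups"
begin

text \<open>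
  The root system of type B in its standard realisation inside \<open>carrier_vec n\<close>, i.e. real
  \<open>n\<close>-space with the standard inner product. Coordinates of vectors are numbered from \<open>0\<close>,
  while the standard basis, the simple roots and the simple reflections are numbered
  from \<open>1\<close> to \<open>n\<close>.
\<close>

definition basis_vec :: "nat \<Rightarrow> nat \<Rightarrow> real vec" where
  "basis_vec n i = unit_vec n (i - 1)"

definition roots :: "nat \<Rightarrow> real vec set" where
  "roots n =
     {a \<cdot>\<^sub>v basis_vec n i | a i. a \<in> {1, -1} \<and> i \<in> {1..n}} \<union>
     {a \<cdot>\<^sub>v basis_vec n i + b \<cdot>\<^sub>v basis_vec n j | a b i j.
        a \<in> {1, -1} \<and> b \<in> {1, -1} \<and> i \<in> {1..n} \<and> j \<in> {1..n} \<and> i < j}"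

definition simple_root :: "nat \<Rightarrow> nat \<Rightarrow> real vec" where
  "simple_root n i =
     (if i = n then basis_vec n n else basis_vec n i - basis_vec n (i + 1))"

definition positive_root :: "nat \<Rightarrow> real vec \<Rightarrow> bool" where
  "positive_root n \<beta> \<longleftrightarrow> \<beta> \<in> roots n \<and>
     (\<exists>k :: nat \<Rightarrow> nat. \<beta> = finsum_vec TYPE(real) n (\<lambda>i. real (k i) \<cdot>\<^sub>v simple_root n i) {1..n})"

definition negative_root :: "nat \<Rightarrow> real vec \<Rightarrow> bool" where
  "negative_root n \<beta> \<longleftrightarrow> \<beta> \<in> roots n \<and> positive_root n (- \<beta>)"

text \<open>
  Reflections are made extensional on \<open>carrier_vec n\<close>, so that they are elements of
  \<open>BijGroup (carrier_vec n)\<close>, whose multiplication is composition (the right factor acts first).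
\<close>

definition reflection :: "nat \<Rightarrow> real vec \<Rightarrow> real vec \<Rightarrow> real vec" where
  "reflection n \<beta> = (\<lambda>v \<in> carrier_vec n. v - (2 * (v \<bullet> \<beta>) / (\<beta> \<bullet> \<beta>)) \<cdot>\<^sub>v \<beta>)"

definition weyl_group :: "nat \<Rightarrow> (real vec \<Rightarrow> real vec) monoid" where
  "weyl_group n = (BijGroup (carrier_vec n))
     \<lparr>carrier := generate (BijGroup (carrier_vec n)) (reflection n ` roots n)\<rparr>"

definition simple_reflection :: "nat \<Rightarrow> nat \<Rightarrow> real vec \<Rightarrow> real vec" where
  "simple_reflection n i = reflection n (simple_root n i)"

definition initial_product :: "nat \<Rightarrow> nat \<Rightarrow> real vec \<Rightarrow> real vec" where
  \<comment> \<open>the ordered product of the simple reflections number \<open>1, 2, \<dots>, m\<close> in the Weyl group\<close>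
  "initial_product n m =
     foldr (\<lambda>i w. simple_reflection n i \<otimes>\<^bsub>weyl_group n\<^esub> w) [1..<Suc m] \<one>\<^bsub>weyl_group n\<^esub>"

definition coxeter_element :: "nat \<Rightarrow> real vec \<Rightarrow> real vec" where
  "coxeter_element n = initial_product n n"

definition T :: "nat \<Rightarrow> nat \<Rightarrow> real vec \<Rightarrow> real vec" where
  "T n r = (coxeter_element n [^]\<^bsub>weyl_group n\<^esub> (r - 1)) \<otimes>\<^bsub>weyl_group n\<^esub> initial_product n (n - 1)"

lemma basis_vec_carrier [simp]: "basis_vec n i \<in> carrier_vec n"
  by (simp add: basis_vec_def)

lemma roots_carrier: "\<beta> \<in> roots n \<Longrightarrow> \<beta> \<in> carrier_vec n"
  by (auto simp: roots_def)

lemma simple_root_in_roots: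
  assumes "1 \<le> i" "i \<le> n"
  shows "simple_root n i \<in> roots n"
proof (cases "i = n")
  case True
  have "basis_vec n n = 1 \<cdot>\<^sub>v basis_vec n n" by simp
  then show ?thesis using True assms unfolding roots_def simple_root_def by fastforce
next
  case False
  have "basis_vec n i - basis_vec n (i + 1) =
      1 \<cdot>\<^sub>v basis_vec n i + (-1) \<cdot>\<^sub>v basis_vec n (i + 1)"
    by (auto simp: basis_vec_def)
  moreover have "i + 1 \<in> {1..n}" "i \<in> {1..n}" "i < i + 1" using assms False by auto
  ultimately show ?thesis using False unfolding roots_def simple_root_def
    by (metis (mono_tags, lifting) UnI2 insertI1 insertI2 mem_Collect_eq)
qed

lemma reflection_Bij:
  assumes "\<beta> \<in> carrier_vec n"
  shows "reflection n \<beta> \<in> carrier (BijGroup (carrier_vec n))"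
proof -
  let ?r = "reflection n \<beta>"
  have cl: "?r v \<in> carrier_vec n" if "v \<in> carrier_vec n" for v
    using that assms by (simp add: reflection_def)
  have inv: "?r (?r v) = v" if v: "v \<in> carrier_vec n" for v
  proof -
    define q where "q = 2 * (v \<bullet> \<beta>) / (\<beta> \<bullet> \<beta>)"
    have rv: "?r v = v - q \<cdot>\<^sub>v \<beta>" using v by (simp add: reflection_def q_def)
    have "(?r v) \<bullet> \<beta> = v \<bullet> \<beta> - q * (\<beta> \<bullet> \<beta>)"
      unfolding rv using v assms by (simp add: minus_scalar_prod_distrib[of _ n])
    then have "2 * ((?r v) \<bullet> \<beta>) / (\<beta> \<bullet> \<beta>) = - q"
      by (cases "\<beta> \<bullet> \<beta> = 0") (auto simp: q_def field_simps)
    then have "?r (?r v) = (v - q \<cdot>\<^sub>v \<beta>) - (- q) \<cdot>\<^sub>v \<beta>"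
      using cl[OF v] rv by (simp add: reflection_def)
    also have "\<dots> = v" using v assms by auto
    finally show ?thesis .
  qed
  have "bij_betw ?r (carrier_vec n) (carrier_vec n)"
    by (rule bij_betw_byWitness[of _ ?r]) (use cl inv in auto)
  then show ?thesis by (simp add: BijGroup_def Bij_def reflection_def)
qed

lemma group_weyl_group: "group (weyl_group n)"
proof -
  interpret G: group "BijGroup (carrier_vec n :: real vec set)" by (rule group_BijGroup)
  have "reflection n ` roots n \<subseteq> carrier (BijGroup (carrier_vec n))"
    using reflection_Bij roots_carrier by auto
  then show ?thesis unfolding weyl_group_def
    using G.generate_is_subgroup G.subgroup_imp_group by blast
qed

lemma simple_reflection_in_weyl_group:
  assumes "1 \<le> i" "i \<le> n"
  shows "simple_reflection n i \<in> carrier (weyl_group n)"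
  using simple_root_in_roots[OF assms]
  by (auto simp: weyl_group_def simple_reflection_def intro: generate.incl)

lemma initial_product_in_weyl_group:
  assumes "m \<le> n"
  shows "initial_product n m \<in> carrier (weyl_group n)"
proof -
  interpret W: group "weyl_group n" by (rule group_weyl_group)
  have "foldr (\<lambda>i w. simple_reflection n i \<otimes>\<^bsub>weyl_group n\<^esub> w) is \<one>\<^bsub>weyl_group n\<^esub>
      \<in> carrier (weyl_group n)" if "set is \<subseteq> {1..n}" for "is"
    using that by (induction "is") (auto intro!: W.m_closed simple_reflection_in_weyl_group)
  moreover have "set [1..<Suc m] \<subseteq> {1..n}" using assms by auto
  ultimately show ?thesis unfolding initial_product_def .
qed

lemma T_in_weyl_group: "T n r \<in> carrier (weyl_group n)"
proof -
  interpret W: group "weyl_group n" by (rule group_weyl_group)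
  show ?thesis unfolding T_def coxeter_element_def
    by (simp add: initial_product_in_weyl_group)
qed

end

theory Submission
  imports Defs
begin

text \<open>
  The argument is carried out in coordinates. The element \<open>s\<^sub>1 \<dots> s\<^sub>m\<close> with \<open>m < n\<close> permutes the standard
  basis by the cycle \<open>e\<^sub>1 \<mapsto> e\<^sub>2 \<mapsto> \<dots> \<mapsto> e\<^bsub>m+1\<^esub> \<mapsto> e\<^sub>1\<close>, while \<open>c\<close> sends \<open>e\<^sub>i\<close> to \<open>e\<^bsub>i+1\<^esub>\<close> for \<open>i < n\<close>
  and \<open>e\<^sub>n\<close> to \<open>-e\<^sub>1\<close>. Hence \<open>T\<^sub>r(\<alpha>\<^sub>j) = -(e\<^sub>a - e\<^bsub>a+1\<^esub>)\<close> with \<open>a = j + r - n \<ge> 1\<close> if \<open>j < n - 1\<close>, and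
  \<open>T\<^sub>r(\<alpha>\<^bsub>n-1\<^esub>) = -(e\<^bsub>r-1\<^esub> + e\<^sub>r)\<close>.
\<close>

section \<open>Coordinates and positivity of roots\<close>

lemma dim_basis_vec [simp]: "dim_vec (basis_vec n i) = n"
  by (simp add: basis_vec_def)

lemma simple_root_carrier [simp]: "simple_root n i \<in> carrier_vec n"
  by (simp add: simple_root_def)

lemma dim_simple_root [simp]: "dim_vec (simple_root n i) = n"
  using carrier_vecD[OF simple_root_carrier] .

lemma basis_vec_index:
  "k < n \<Longrightarrow> 1 \<le> i \<Longrightarrow> basis_vec n i $ k = (if Suc k = i then 1 else 0)"
  by (auto simp: basis_vec_def unit_vec_def)

text \<open>One formula also covers \<open>i = n\<close>: the subtracted term would sit at
  coordinate \<open>n\<close>, which \<open>k < n\<close> excludes.\<close>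

lemma simple_root_index:
  assumes "k < n" "1 \<le> i" "i \<le> n"
  shows "simple_root n i $ k = (if Suc k = i then 1 else 0) - (if k = i then 1 else 0)"
  using assms by (auto simp: simple_root_def basis_vec_index)

text \<open>Coordinate \<open>k\<close> meets only the simple roots numbered \<open>Suc k\<close>
  and \<open>k\<close>; for \<open>k = 0\<close> the second does not exist.\<close>

lemma finsum_simple_root_index:
  assumes "k < n"
  shows "finsum_vec TYPE(real) n (\<lambda>i. c i \<cdot>\<^sub>v simple_root n i) {1..n} $ k =
    c (Suc k) - (if k = 0 then 0 else c k)"
proof -
  have "finsum_vec TYPE(real) n (\<lambda>i. c i \<cdot>\<^sub>v simple_root n i) {1..n} $ k =
      (\<Sum>i\<in>{1..n}. (c i \<cdot>\<^sub>v simple_root n i) $ k)"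
    using assms by (subst index_finsum_vec) auto
  also have "\<dots> = (\<Sum>i\<in>{1..n}. (if Suc k = i then c i else 0) - (if k = i then c i else 0))"
    using assms
    by (intro sum.cong refl) (simp add: simple_root_index)
  also have "\<dots> = c (Suc k) - (if k = 0 then 0 else c k)"
    using assms by (simp add: sum_subtractf)
  finally show ?thesis .
qed

text \<open>Comparing coordinates forces the coefficients to be the partial sums of the entries of
  \<open>\<beta>\<close>, so it suffices to exhibit natural numbers with the prescribed
  differences.\<close>

lemma positive_rootI:
  fixes c :: "nat \<Rightarrow> nat"
  assumes "\<beta> \<in> roots n"
    and "\<And>k. k < n \<Longrightarrow> \<beta> $ k = real (c (Suc k)) - (if k = 0 then 0 else real (c k))"
  shows "positive_root n \<beta>"
proof -
  have "\<beta> = finsum_vec TYPE(real) n (\<lambda>i. real (c i) \<cdot>\<^sub>v simple_root n i) {1..n}" (is "_ = ?s")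
  proof (rule eq_vecI)
    have s: "?s \<in> carrier_vec n" by (rule finsum_vec_closed) auto
    with assms(1) show "dim_vec \<beta> = dim_vec ?s" using roots_carrier by fastforce
    fix k assume "k < dim_vec ?s"
    with s have "k < n" by simp
    then show "\<beta> $ k = ?s $ k" by (simp only: assms(2) finsum_simple_root_index)
  qed
  with assms(1) show ?thesis unfolding positive_root_def by blast
qed

lemma basis_combination_in_roots:
  assumes "a \<in> {1, -1}" "b \<in> {1, -1}" "1 \<le> i" "i < j" "j \<le> n"
  shows "a \<cdot>\<^sub>v basis_vec n i + b \<cdot>\<^sub>v basis_vec n j \<in> roots n"
proof -
  have "i \<in> {1..n}" "j \<in> {1..n}" using assms by auto
  with assms(1,2,4) show ?thesis unfolding roots_def by blast
qed

text \<open>As \<open>a < n\<close>, this is the simple root numbered \<open>a\<close>; it is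
  written as a signed combination to fit \<open>negative_rootI\<close>.\<close>

lemma positive_root_diff_Suc:
  assumes "1 \<le> a" "a < n"
  shows "positive_root n (1 \<cdot>\<^sub>v basis_vec n a + (-1) \<cdot>\<^sub>v basis_vec n (Suc a))"
  using assms
  by (intro positive_rootI[where c = "\<lambda>i. if i = a then 1 else 0"] basis_combination_in_roots)
    (auto simp: basis_vec_index)

text \<open>The coefficients come from \<open>e\<^sub>a + e\<^bsub>a+1\<^esub> = \<alpha>\<^sub>a + 2 (\<alpha>\<^bsub>a+1\<^esub> + \<dots> + \<alpha>\<^sub>n)\<close>.\<close>

lemma positive_root_add_Suc:
  assumes "1 \<le> a" "a < n"
  shows "positive_root n (1 \<cdot>\<^sub>v basis_vec n a + 1 \<cdot>\<^sub>v basis_vec n (Suc a))"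
  using assms
  by (intro positive_rootI[where c = "\<lambda>i. if i < a then 0 else if i = a then 1 else 2"]
        basis_combination_in_roots)
    (auto simp: basis_vec_index)

lemma negative_rootI:
  assumes "a \<in> {1, -1}" "b \<in> {1, -1}" "1 \<le> i" "i < j" "j \<le> n"
    and "positive_root n (a \<cdot>\<^sub>v basis_vec n i + b \<cdot>\<^sub>v basis_vec n j)"
    and "\<beta> \<in> carrier_vec n"
    and "\<And>k. k < n \<Longrightarrow> \<beta> $ k = - (if Suc k = i then a else 0) - (if Suc k = j then b else 0)"
  shows "negative_root n \<beta>"
proof -
  have "\<beta> = (-a) \<cdot>\<^sub>v basis_vec n i + (-b) \<cdot>\<^sub>v basis_vec n j"
    using assms by (intro eq_vecI) (auto simp: basis_vec_index)
  moreover have "(-a) \<cdot>\<^sub>v basis_vec n i + (-b) \<cdot>\<^sub>v basis_vec n j \<in> roots n"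
    using assms by (intro basis_combination_in_roots) auto
  moreover have "- \<beta> = a \<cdot>\<^sub>v basis_vec n i + b \<cdot>\<^sub>v basis_vec n j"
    using assms by (intro eq_vecI) (auto simp: basis_vec_index)
  ultimately show ?thesis using assms(6) by (simp add: negative_root_def)
qed

section \<open>The Weyl group as maps of vectors\<close>

lemma weyl_group_carrier_Bij:
  assumes "w \<in> carrier (weyl_group n)"
  shows "w \<in> Bij (carrier_vec n)"
proof -
  interpret G: group "BijGroup (carrier_vec n :: real vec set)" by (rule group_BijGroup)
  have "reflection n ` roots n \<subseteq> carrier (BijGroup (carrier_vec n))"
    using reflection_Bij roots_carrier by auto
  moreover have "w \<in> generate (BijGroup (carrier_vec n)) (reflection n ` roots n)"
    using assms by (simp add: weyl_group_def)
  ultimately have "w \<in> carrier (BijGroup (carrier_vec n))"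
    by (rule G.generate_in_carrier)
  then show ?thesis by (simp only: BijGroup_def partial_object.select_convs)
qed

lemma weyl_group_closed:
  assumes "w \<in> carrier (weyl_group n)" "v \<in> carrier_vec n"
  shows "w v \<in> carrier_vec n"
  using funcset_mem[OF Bij_imp_funcset[OF weyl_group_carrier_Bij[OF assms(1)]] assms(2)] .

lemma simple_reflection_closed:
  assumes "1 \<le> i" "i \<le> n" "v \<in> carrier_vec n"
  shows "simple_reflection n i v \<in> carrier_vec n"
  using weyl_group_closed[OF simple_reflection_in_weyl_group[OF assms(1,2)] assms(3)] .

text \<open>Multiplication in \<open>BijGroup\<close> is composition restricted to the carrier, so
  \<open>v\<close> has to lie there.\<close>

lemma weyl_group_mult_apply:
  assumes "g \<in> carrier (weyl_group n)" "h \<in> carrier (weyl_group n)" "v \<in> carrier_vec n"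
  shows "(g \<otimes>\<^bsub>weyl_group n\<^esub> h) v = g (h v)"
  using assms weyl_group_carrier_Bij[of g n] weyl_group_carrier_Bij[of h n]
  by (simp add: weyl_group_def BijGroup_def compose_def)

lemma weyl_group_one_apply:
  "v \<in> carrier_vec n \<Longrightarrow> \<one>\<^bsub>weyl_group n\<^esub> v = v"
  by (simp add: weyl_group_def BijGroup_def)

section \<open>Simple reflections in coordinates\<close>

lemma scalar_prod_basis_vec:
  "v \<in> carrier_vec n \<Longrightarrow> 1 \<le> i \<Longrightarrow> i \<le> n \<Longrightarrow> v \<bullet> basis_vec n i = v $ (i - 1)"
  by (simp add: basis_vec_def)

text \<open>The root has squared length 2, so the multiple of it that is subtracted is the
  difference of two adjacent coordinates, which swaps them.\<close>

lemma simple_reflection_swap_index: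
  assumes "1 \<le> i" "i < n" "v \<in> carrier_vec n" "k < n"
  shows "simple_reflection n i v $ k =
    (if Suc k = i then v $ i else if k = i then v $ (i - 1) else v $ k)"
proof -
  have ip: "u \<bullet> simple_root n i = u $ (i - 1) - u $ i" if "u \<in> carrier_vec n" for u
    using that assms
    by (simp add: simple_root_def scalar_prod_minus_distrib[of _ n] scalar_prod_basis_vec)
  have "simple_root n i \<bullet> simple_root n i = 2"
    using assms by (auto simp: ip simple_root_index)
  then have "simple_reflection n i v = v - (v $ (i - 1) - v $ i) \<cdot>\<^sub>v simple_root n i"
    using assms by (simp add: simple_reflection_def reflection_def ip)
  then show ?thesis
    using assms by (auto simp: simple_root_index)
qed

text \<open>The short simple root is a unit vector, so twice the last coordinate is subtracted,
  reversing its sign.\<close>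

lemma simple_reflection_last_index:
  assumes "v \<in> carrier_vec n" "k < n"
  shows "simple_reflection n n v $ k = (if Suc k = n then - v $ k else v $ k)"
proof -
  have ip: "u \<bullet> simple_root n n = u $ (n - 1)" if "u \<in> carrier_vec n" for u
    using that assms by (simp add: simple_root_def scalar_prod_basis_vec)
  have "simple_root n n \<bullet> simple_root n n = 1"
    using assms by (auto simp: ip simple_root_index)
  then have "simple_reflection n n v = v - (2 * v $ (n - 1)) \<cdot>\<^sub>v simple_root n n"
    using assms by (simp add: simple_reflection_def reflection_def ip)
  then show ?thesis
    using assms by (auto simp: simple_root_index)
qed

section \<open>Initial products, powers of the Coxeter element and \<open>T n r\<close> in
  coordinates\<close>

lemma initial_product_Suc_apply:
  assumes "Suc m \<le> n" "v \<in> carrier_vec n"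
  shows "initial_product n (Suc m) v = initial_product n m (simple_reflection n (Suc m) v)"
proof -
  interpret W: group "weyl_group n" by (rule group_weyl_group)
  let ?f = "\<lambda>is z. foldr (\<lambda>i w. simple_reflection n i \<otimes>\<^bsub>weyl_group n\<^esub> w) is z"
  let ?s = "simple_reflection n (Suc m)"
  have s: "?s \<in> carrier (weyl_group n)"
    using assms by (intro simple_reflection_in_weyl_group) auto
  \<comment> \<open>Moving the starting value \<open>?s\<close> out of \<open>foldr\<close> takes
    associativity, so closure is proved in the same induction.\<close>
  have "?f is \<one>\<^bsub>weyl_group n\<^esub> \<in> carrier (weyl_group n) \<and>
      ?f is ?s = ?f is \<one>\<^bsub>weyl_group n\<^esub> \<otimes>\<^bsub>weyl_group n\<^esub> ?s" if "set is \<subseteq> {1..n}" for "is"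
    using that
    by (induction "is") (auto simp: s simple_reflection_in_weyl_group W.m_assoc)
  moreover have "set [1..<Suc m] \<subseteq> {1..n}" using assms(1) by auto
  ultimately have "?f [1..<Suc m] ?s = ?f [1..<Suc m] \<one>\<^bsub>weyl_group n\<^esub> \<otimes>\<^bsub>weyl_group n\<^esub> ?s"
    by blast
  moreover have "[1..<Suc (Suc m)] = [1..<Suc m] @ [Suc m]" by simp
  ultimately have "initial_product n (Suc m) = initial_product n m \<otimes>\<^bsub>weyl_group n\<^esub> ?s"
    by (simp only: initial_product_def foldr_append foldr.simps o_apply id_apply W.r_one[OF s])
  with assms s show ?thesis
    by (simp add: weyl_group_mult_apply initial_product_in_weyl_group)
qed

text \<open>The rightmost factor acts first, so splitting it off changes the vector; hence the
  induction is over arbitrary \<open>v\<close>.\<close>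

lemma initial_product_index:
  assumes "m < n" "v \<in> carrier_vec n" "k < n"
  shows "initial_product n m v $ k =
    (if k = 0 then v $ m else if k \<le> m then v $ (k - 1) else v $ k)"
  using assms
proof (induction m arbitrary: v)
  case 0
  then show ?case by (simp add: initial_product_def weyl_group_one_apply)
next
  case (Suc m)
  let ?u = "simple_reflection n (Suc m) v"
  have "initial_product n (Suc m) v $ k = initial_product n m ?u $ k"
    using Suc.prems by (simp add: initial_product_Suc_apply)
  also have "\<dots> = (if k = 0 then ?u $ m else if k \<le> m then ?u $ (k - 1) else ?u $ k)"
    using Suc.prems by (intro Suc.IH simple_reflection_closed) auto
  also have "\<dots> = (if k = 0 then v $ Suc m else if k \<le> Suc m then v $ (k - 1) else v $ k)"
  proof -
    consider "k \<le> m" | "k = Suc m" | "Suc m < k" by linarith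
    then show ?thesis
      using Suc.prems by cases (auto simp: simple_reflection_swap_index)
  qed
  finally show ?case .
qed

text \<open>The factor \<open>s\<^sub>n\<close> negates the last coordinate, and the remaining cycle
  then moves it to the front.\<close>

lemma coxeter_element_index:
  assumes "v \<in> carrier_vec n" "k < n"
  shows "coxeter_element n v $ k = (if k = 0 then - v $ (n - 1) else v $ (k - 1))"
proof -
  obtain m where n: "n = Suc m" using assms by (cases n) auto
  have "simple_reflection n n v \<in> carrier_vec n"
    using assms by (simp add: simple_reflection_closed)
  with assms show ?thesis
    unfolding coxeter_element_def n
    by (auto simp: initial_product_Suc_apply initial_product_index simple_reflection_last_index)
qed

text \<open>Each step is a cyclic shift in which the entry passing the end returns negated;
  \<open>q \<le> n\<close> ensures that none passes twice.\<close>

lemma coxeter_element_pow_index: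
  assumes "q \<le> n" "v \<in> carrier_vec n" "k < n"
  shows "(coxeter_element n [^]\<^bsub>weyl_group n\<^esub> q) v $ k =
    (if q \<le> k then v $ (k - q) else - v $ (n + k - q))"
  using assms
proof (induction q arbitrary: v)
  case 0
  then show ?case by (simp add: weyl_group_one_apply)
next
  case (Suc q)
  interpret W: group "weyl_group n" by (rule group_weyl_group)
  have c: "coxeter_element n \<in> carrier (weyl_group n)"
    by (simp add: coxeter_element_def initial_product_in_weyl_group)
  have "coxeter_element n v \<in> carrier_vec n"
    using weyl_group_closed[OF c] Suc.prems by simp
  with c Suc have "(coxeter_element n [^]\<^bsub>weyl_group n\<^esub> Suc q) v $ k =
      (if q \<le> k then coxeter_element n v $ (k - q) else - coxeter_element n v $ (n + k - q))"
    by (simp add: weyl_group_mult_apply)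
  also have "\<dots> = (if Suc q \<le> k then v $ (k - Suc q) else - v $ (n + k - Suc q))"
  proof -
    consider "k < q" | "k = q" | "q < k" by linarith
    then show ?thesis
      using Suc.prems by cases (simp_all add: coxeter_element_index)
  qed
  finally show ?case .
qed

text \<open>Since \<open>s\<^sub>n\<close> is an involution,
  \<open>T\<^sub>r = c\<^sup>r s\<^sub>n\<close>: the signed shift by \<open>r\<close>, except that
  the last entry of \<open>v\<close>, landing at \<open>r - 1\<close>, keeps its sign.\<close>

lemma T_index:
  assumes "1 \<le> r" "r \<le> n" "v \<in> carrier_vec n" "k < n"
  shows "T n r v $ k =
    (if r \<le> k then v $ (k - r) else if Suc k = r then v $ (n - 1) else - v $ (n + k - r))"
proof -
  interpret W: group "weyl_group n" by (rule group_weyl_group)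
  have c: "coxeter_element n \<in> carrier (weyl_group n)"
    by (simp add: coxeter_element_def initial_product_in_weyl_group)
  have p: "initial_product n (n - 1) \<in> carrier (weyl_group n)"
    by (simp add: initial_product_in_weyl_group)
  let ?u = "initial_product n (n - 1) v"
  have "T n r v $ k = (coxeter_element n [^]\<^bsub>weyl_group n\<^esub> (r - 1)) ?u $ k"
    using c p assms by (simp add: T_def weyl_group_mult_apply)
  also have "\<dots> = (if r - 1 \<le> k then ?u $ (k - (r - 1)) else - ?u $ (n + k - (r - 1)))"
    using assms weyl_group_closed[OF p] by (intro coxeter_element_pow_index) auto
  also have "\<dots> =
      (if r \<le> k then v $ (k - r) else if Suc k = r then v $ (n - 1) else - v $ (n + k - r))"
  proof -
    consider "Suc k < r" | "Suc k = r" | "r \<le> k" by linarith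
    then show ?thesis
      using assms by cases (auto simp: initial_product_index)
  qed
  finally show ?thesis .
qed

theorem lemma5p9:
  fixes n r j :: nat
  assumes "3 \<le> n"
    and "2 \<le> r" and "r \<le> n"
    and "n + 1 - r \<le> j" and "j \<le> n - 1"
  shows "negative_root n (T n r (simple_root n j))"
proof -
  have carr: "T n r (simple_root n j) \<in> carrier_vec n"
    by (rule weyl_group_closed[OF T_in_weyl_group simple_root_carrier])
  show ?thesis
  proof (cases "j = n - 1")
    case True
    have "1 \<le> r - 1" "r - 1 < n" "Suc (r - 1) = r" using assms by auto
    with positive_root_add_Suc[of "r - 1" n]
    have pos: "positive_root n (1 \<cdot>\<^sub>v basis_vec n (r - 1) + 1 \<cdot>\<^sub>v basis_vec n r)" by simp
    show ?thesis
    proof (rule negative_rootI[OF _ _ _ _ _ pos carr])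
      fix k assume "k < n"
      \<comment> \<open>The entries 1 and -1 at \<open>n - 2\<close> and \<open>n - 1\<close> land
        at \<open>r - 2\<close> and \<open>r - 1\<close>. Only the first is negated, so both become
        -1. In the last case \<open>2 \<le> r\<close> keeps \<open>k - r\<close> below
        \<open>n - 2\<close>.\<close>
      consider "Suc (Suc k) < r" | "Suc (Suc k) = r" | "Suc k = r" | "r \<le> k" by linarith
      then show "T n r (simple_root n j) $ k =
          - (if Suc k = r - 1 then 1 else 0) - (if Suc k = r then 1 else 0)"
        using \<open>k < n\<close> assms True by cases (auto simp: T_index simple_root_index)
    qed (use assms in auto)
  next
    case False
    \<comment> \<open>Shifting by \<open>r\<close> modulo \<open>n\<close> takes position
      \<open>j\<close> to \<open>a\<close>; the lower bound on \<open>j\<close> makes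
      \<open>a\<close> at least 1, so the subtraction is not truncated.\<close>
    define a where "a = j + r - n"
    have a: "1 \<le> a" "a < n" "Suc a < r" "j = n + a - r" using assms False by (auto simp: a_def)
    show ?thesis
    proof (rule negative_rootI[OF _ _ _ _ _ positive_root_diff_Suc[OF a(1,2)] carr])
      fix k assume k: "k < n"
      have j: "simple_root n j $ i = (if Suc i = j then 1 else 0) - (if i = j then 1 else 0)"
        if "i < n" for i
        using that assms by (intro simple_root_index) auto
      \<comment> \<open>In the first case the entries at \<open>j - 1\<close> and \<open>j\<close>
        arrive negated at \<open>a - 1\<close> and \<open>a\<close>. In the other two only zeros
        arrive, by \<open>j < n - 1\<close> and \<open>n - r < j\<close> respectively.\<close>
      consider "Suc k < r" | "Suc k = r" | "r \<le> k" by linarith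
      then show "T n r (simple_root n j) $ k =
          - (if Suc k = a then 1 else 0) - (if Suc k = Suc a then - 1 else 0)"
      proof cases
        case 1
        with k assms have "T n r (simple_root n j) $ k = - simple_root n j $ (n + k - r)"
          by (simp add: T_index)
        moreover have "n + k - r < n" "Suc (n + k - r) = j \<longleftrightarrow> Suc k = a" "n + k - r = j \<longleftrightarrow> k = a"
          using 1 a assms(3) by linarith+
        ultimately show ?thesis by (simp add: j)
      next
        case 2
        with k assms False a(3) show ?thesis by (simp add: T_index j)
      next
        case 3
        with k assms have "T n r (simple_root n j) $ k = simple_root n j $ (k - r)"
          by (simp add: T_index)
        moreover have "k - r < n" "Suc (k - r) \<noteq> j" "k - r \<noteq> j" "Suc k \<noteq> a" "k \<noteq> a"
          using 3 k a assms(3) by linarith+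
        ultimately show ?thesis by (simp add: j)
      qed
    qed (use a in auto)
  qed
qed

end
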